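(* Let $s\in(0,1)$ and $N_x,N_y\in\mathbb N$. Let $\mathbf x=(x_1,\dots,x_{N_x})^T$ and $\mathbf y=(y_1,\dots,y_{N_y})^T$ be vectors of (real) nodes on the $x$-axis and the $y$-axis. Let $\mathbf D_{xx}\in\mathbb R^{N_x\times N_x}$ and $\mathbf D_{yy}\in\mathbb R^{N_y\times N_y}$ be diagonalizable and negative semidefinite differentiation matrices associated to $\mathbf x$ and $\mathbf y$ (used as discretizations of $\partial_{xx}$ and $\partial_{yy}$), with $$\mathbf D_{xx}=\mathbf P_x\,\boldsymbol\Lambda_x\,\mathbf P_x^{-1},\qquad \mathbf D_{yy}=\mathbf P_y\,\boldsymbol\Lambda_y\,\mathbf P_y^{-1},$$ where $\mathbf P_x\in\mathbb R^{N_x\times N_x}$, $\mathbf P_y\in\mathbb R^{N_y\times N_y}$ are invertible eigenvector matrices, $\boldsymbol\Lambda_x=\operatorname{diag}(\lambda_{x,1},\dots,\lambda_{x,N_x})$, $\boldsymbol\Lambda_y=\operatorname{diag}(\lambda_{y,1},\dots,\lambda_{y,N_y})$, and all eigenvalues satisfy $\lambda_{x,i}\le 0$, $\lambda_{y,j}\le 0$. Let $u$ be a complex-valued function on $\mathbb R^2$, and let $\mathbf U\in\mathbb C^{N_x\times N_y}$ be the matrix with $[\mathbf U]_{ij}=u(x_i,y_j)$. Let $\boldsymbol\Lambda_{xy}\in\mathbb R^{N_x\times N_y}$ be the matrix with $[\boldsymbol\Lambda_{xy}]_{ij}=\lambda_{x,i}+\lambda_{y,j}$. Then the numerical approximation of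 the Balakrishnan representation of $(-\Delta)^su$ and the numerical approximation of the Bochner representation of $(-\Delta)^su$ at the nodes (both obtained by replacing $\Delta$ by its discretization $\Delta_h$ and $u$ by $\mathbf U$, where $\Delta_h\mathbf V=\mathbf D_{xx}\mathbf V+\mathbf V\mathbf D_{yy}^T$) are both given by the same formula, namely $$\frac{\sin(\pi s)}{\pi}\int_0^\infty(-\Delta_h)(t-\Delta_h)^{-1}[\mathbf U]\,\frac{dt}{t^{1-s}}=\frac{1}{\Gamma(-s)}\int_0^\infty\bigl(e^{t\Delta_h}[\mathbf U]-\mathbf U\bigr)\frac{dt}{t^{1+s}}=\mathbf P_x\Bigl[(-\boldsymbol\Lambda_{xy})^{\odot s}\odot\bigl[\mathbf P_x^{-1}\,\mathbf U\,(\mathbf P_y^T)^{-1}\bigr]\Bigr]\mathbf P_y^T .$$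
   Context: For $u:\mathbb R^n\to\mathbb C$ and $s\in(0,1)$ the Balakrishnan and Bochner representations of the fractional Laplacian are $$(-\Delta)^su(\vec x)=\frac{\sin(\pi s)}{\pi}\int_0^\infty(-\Delta)(t-\Delta)^{-1}[u](\vec x)\frac{dt}{t^{1-s}},\qquad (-\Delta)^su(\vec x)=\frac1{\Gamma(-s)}\int_0^\infty\bigl(e^{t\Delta}[u](\vec x)-u(\vec x)\bigr)\frac{dt}{t^{1+s}}.$$ Numerical approximation: the Laplacian in dimension $n=2$ is replaced by the linear operator $\Delta_h:\mathbb C^{N_x\times N_y}\to\mathbb C^{N_x\times N_y}$, $\Delta_h\mathbf V=\mathbf D_{xx}\mathbf V+\mathbf V\mathbf D_{yy}^T$. For $t>0$, $(t-\Delta_h)^{-1}[\mathbf U]$ is the unique solution $\mathbf V$ of $t\mathbf V-\mathbf D_{xx}\mathbf V-\mathbf V\mathbf D_{yy}^T=\mathbf U$, and $e^{t\Delta_h}[\mathbf U]=e^{t\mathbf D_{xx}}\,\mathbf U\,e^{t\mathbf D_{yy}^T}$. Integrals of matrix-valued functions are taken entrywise. "Negative semidefinite" means here that all eigenvalues are real and $\le0$ (the matrices need not be symmetric). $\odot$ is the entrywise (Hadamard) product, and $(\cdot)^{\odot s}$ is the entrywise power of order $s$, with $0^s=0$. $\Gamma$ is Euler's Gamma function. *)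

theory Defs
  imports "HOL-Analysis.Analysis"
begin

text \<open>
  A matrix with rows indexed by the type 'm and columns by the type 'n is an element of
  'a ^ 'n ^ 'm. On this type the product of the library written with a single star is the
  entrywise (Hadamard) product, while \<open>**\<close> is the matrix product.
\<close>

abbreviation cmat :: "real ^ 'n ^ 'm \<Rightarrow> complex ^ 'n ^ 'm" where
  "cmat A \<equiv> map_matrix complex_of_real A"

definition diag_matrix :: "'a::zero ^ 'n \<Rightarrow> 'a ^ 'n ^ 'n" where
  "diag_matrix d = (\<chi> i j. if i = j then d $ i else 0)"

text \<open>The matrix is not required to be symmetric, so that the condition is on all complex
  eigenvalues and not on a quadratic form.\<close>

definition complex_eigenvalue :: "real ^ 'n ^ 'n \<Rightarrow> complex \<Rightarrow> bool" where
  "complex_eigenvalue A \<mu> \<longleftrightarrow> (\<exists>v. v \<noteq> 0 \<and> cmat A *v v = \<mu> *s v)"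

definition neg_semidefinite :: "real ^ 'n ^ 'n \<Rightarrow> bool" where
  "neg_semidefinite A \<longleftrightarrow> (\<forall>\<mu>. complex_eigenvalue A \<mu> \<longrightarrow> \<mu> \<in> \<real> \<and> Re \<mu> \<le> 0)"

text \<open>Since \<open>0 powr s = 0\<close>, the convention for zero entries is that of \<open>powr\<close>.\<close>

definition entrywise_powr :: "real ^ 'n ^ 'm \<Rightarrow> real \<Rightarrow> real ^ 'n ^ 'm" where
  "entrywise_powr A s = map_matrix (\<lambda>a. a powr s) A"

definition matrix_power :: "'a::semiring_1 ^ 'n ^ 'n \<Rightarrow> nat \<Rightarrow> 'a ^ 'n ^ 'n" where
  "matrix_power A k = (((**) A) ^^ k) (mat 1)"

text \<open>The library function \<open>exp\<close> is not available for square matrices with the matrix product,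
  hence the power series.\<close>

definition matrix_exp :: "complex ^ 'n ^ 'n \<Rightarrow> complex ^ 'n ^ 'n" where
  "matrix_exp A = (\<Sum>k. (1 / fact k) *\<^sub>R matrix_power A k)"

lemma matrix_norm_le_sum_entries:
  fixes A :: "complex ^ 'n ^ 'm"
  shows "norm A \<le> (\<Sum>i\<in>UNIV. \<Sum>j\<in>UNIV. norm (A $ i $ j))"
proof -
  have "norm A \<le> (\<Sum>i\<in>UNIV. norm (A $ i))"
    unfolding norm_vec_def[of A] by (rule L2_set_le_sum) simp
  also have "\<dots> \<le> (\<Sum>i\<in>UNIV. \<Sum>j\<in>UNIV. norm (A $ i $ j))"
    by (intro sum_mono) (simp add: norm_vec_def L2_set_le_sum)
  finally show ?thesis .
qed

lemma matrix_power_entry_bound: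
  fixes A :: "complex ^ 'n ^ 'n"
  defines "c \<equiv> (\<Sum>i\<in>UNIV. \<Sum>j\<in>UNIV. norm (A $ i $ j))"
  shows "norm (matrix_power A k $ i $ j) \<le> c ^ k"
proof (induction k arbitrary: i j)
  case 0
  then show ?case by (simp add: matrix_power_def mat_def)
next
  case (Suc k)
  have c0: "0 \<le> c" unfolding c_def by (intro sum_nonneg) auto
  have row: "(\<Sum>l\<in>UNIV. norm (A $ i $ l)) \<le> c"
    unfolding c_def
    by (rule member_le_sum[where f = "\<lambda>i. \<Sum>l\<in>UNIV. norm (A $ i $ l)"])
      (auto intro: sum_nonneg)
  have "norm (matrix_power A (Suc k) $ i $ j)
      = norm (\<Sum>l\<in>UNIV. A $ i $ l * matrix_power A k $ l $ j)"
    by (simp add: matrix_power_def matrix_matrix_mult_def)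
  also have "\<dots> \<le> (\<Sum>l\<in>UNIV. norm (A $ i $ l) * c ^ k)"
    by (intro sum_norm_le) (auto simp: norm_mult intro: mult_left_mono Suc.IH)
  also have "\<dots> = (\<Sum>l\<in>UNIV. norm (A $ i $ l)) * c ^ k"
    by (simp add: sum_distrib_right)
  also have "\<dots> \<le> c ^ Suc k"
    using row c0 by (simp add: mult_right_mono)
  finally show ?case .
qed

lemma matrix_exp_sums:
  fixes A :: "complex ^ 'n ^ 'n"
  shows "(\<lambda>k. (1 / fact k) *\<^sub>R matrix_power A k) sums matrix_exp A"
proof -
  define c where "c = (\<Sum>i\<in>UNIV. \<Sum>j\<in>UNIV. norm (A $ i $ j))"
  define N where "N = real CARD('n) * real CARD('n)"
  have bound: "norm (matrix_power A k) \<le> N * c ^ k" for k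
  proof -
    have "norm (matrix_power A k)
        \<le> (\<Sum>i\<in>UNIV. \<Sum>j\<in>UNIV. norm (matrix_power A k $ i $ j))"
      by (rule matrix_norm_le_sum_entries)
    also have "\<dots> \<le> (\<Sum>i\<in>(UNIV::'n set). \<Sum>j\<in>(UNIV::'n set). c ^ k)"
      unfolding c_def by (intro sum_mono matrix_power_entry_bound)
    finally show ?thesis by (simp add: N_def mult.assoc)
  qed
  have "summable (\<lambda>k. N * (inverse (fact k) * c ^ k))"
    by (intro summable_mult summable_exp)
  then have "summable (\<lambda>k. (1 / fact k) *\<^sub>R matrix_power A k)"
  proof (rule summable_comparison_test[rotated], intro exI allI impI)
    fix k :: nat
    show "norm ((1 / fact k) *\<^sub>R matrix_power A k) \<le> N * (inverse (fact k) * c ^ k)"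
      using bound[of k] by (simp add: divide_simps mult.commute)
  qed
  then show ?thesis by (simp add: matrix_exp_def summable_sums)
qed

definition discrete_laplacian ::
  "real ^ 'm ^ 'm \<Rightarrow> real ^ 'n ^ 'n \<Rightarrow> complex ^ 'n ^ 'm \<Rightarrow> complex ^ 'n ^ 'm" where
  "discrete_laplacian Dxx Dyy V = cmat Dxx ** V + V ** transpose (cmat Dyy)"

definition resolvent_equation ::
  "real ^ 'm ^ 'm \<Rightarrow> real ^ 'n ^ 'n \<Rightarrow> real \<Rightarrow> complex ^ 'n ^ 'm \<Rightarrow> complex ^ 'n ^ 'm \<Rightarrow> bool" where
  "resolvent_equation Dxx Dyy t U V \<longleftrightarrow>
     t *\<^sub>R V - cmat Dxx ** V - V ** transpose (cmat Dyy) = U"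

definition discrete_resolvent ::
  "real ^ 'm ^ 'm \<Rightarrow> real ^ 'n ^ 'n \<Rightarrow> real \<Rightarrow> complex ^ 'n ^ 'm \<Rightarrow> complex ^ 'n ^ 'm" where
  "discrete_resolvent Dxx Dyy t U = (THE V. resolvent_equation Dxx Dyy t U V)"

definition discrete_heat ::
  "real ^ 'm ^ 'm \<Rightarrow> real ^ 'n ^ 'n \<Rightarrow> real \<Rightarrow> complex ^ 'n ^ 'm \<Rightarrow> complex ^ 'n ^ 'm" where
  "discrete_heat Dxx Dyy t U =
     matrix_exp (t *\<^sub>R cmat Dxx) ** U ** matrix_exp (t *\<^sub>R transpose (cmat Dyy))"

text \<open>Integrals over the positive half-line are Lebesgue integrals, taken entrywise.
  The Lebesgue integral of a non-integrable function is 0 by convention, so integrability is a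
  separate predicate.\<close>

definition entrywise_integrable :: "(real \<Rightarrow> complex ^ 'n ^ 'm) \<Rightarrow> bool" where
  "entrywise_integrable F \<longleftrightarrow> (\<forall>i j. set_integrable lborel {0<..} (\<lambda>t. F t $ i $ j))"

definition entrywise_integral :: "(real \<Rightarrow> complex ^ 'n ^ 'm) \<Rightarrow> complex ^ 'n ^ 'm" where
  "entrywise_integral F = (\<chi> i j. LINT t:{0<..}|lborel. F t $ i $ j)"

definition balakrishnan_integrand ::
  "real \<Rightarrow> real ^ 'm ^ 'm \<Rightarrow> real ^ 'n ^ 'n \<Rightarrow> complex ^ 'n ^ 'm \<Rightarrow> real \<Rightarrow> complex ^ 'n ^ 'm" where
  "balakrishnan_integrand s Dxx Dyy U t =
     (1 / t powr (1 - s)) *\<^sub>R (- discrete_laplacian Dxx Dyy (discrete_resolvent Dxx Dyy t U))"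

definition bochner_integrand ::
  "real \<Rightarrow> real ^ 'm ^ 'm \<Rightarrow> real ^ 'n ^ 'n \<Rightarrow> complex ^ 'n ^ 'm \<Rightarrow> real \<Rightarrow> complex ^ 'n ^ 'm" where
  "bochner_integrand s Dxx Dyy U t =
     (1 / t powr (1 + s)) *\<^sub>R (discrete_heat Dxx Dyy t U - U)"

end

theory Submission
  imports Defs
begin

text \<open>
  In the coefficients \<open>W = Px\<^sup>-\<^sup>1 U (Py\<^sup>T)\<^sup>-\<^sup>1\<close> the operator \<open>\<Delta>\<^sub>h\<close> acts as the Hadamard multiplication by \<open>\<Lambda>\<^sub>x\<^sub>y\<close>,
  so that the resolvent and the heat semigroup are Hadamard multiplications too, and both integrals
  reduce to scalar ones with \<open>a = - (lx $ i + ly $ j) \<ge> 0\<close>. These follow from Tonelli's theorem and the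
  Gamma integral, after writing \<open>1 / (t + a)\<close> as the integral of \<open>exp (- (t + a) r)\<close> over \<open>r > 0\<close>, and
  \<open>1 - exp (- a t)\<close> as the integral of \<open>a exp (- a r)\<close> over \<open>0 < r < t\<close>.
\<close>

subsection \<open>Scalar integrals\<close>

text \<open>Substituting \<open>c * t\<close> for \<open>t\<close> in the Gamma integral produces
  the factor \<open>c\<close> from the measure and \<open>c powr (x - 1)\<close> from the integrand,
  together \<open>c powr x\<close>.\<close>

lemma nn_integral_powr_times_exp:
  fixes x c :: real
  assumes "0 < x" "0 < c"
  shows "(\<integral>\<^sup>+t. ennreal (t powr (x - 1) * exp (- (c * t))) * indicator {0<..} t \<partial>lborel)
    = ennreal (Gamma x / c powr x)"
proof -
  have "ennreal (Gamma x) = (\<integral>\<^sup>+t. ennreal (indicator {0..} t * t powr (x - 1) / exp t) \<partial>lborel)"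
    using assms by (intro Gamma_conv_nn_integral_real)
  also have "\<dots> = ennreal c * (\<integral>\<^sup>+t. ennreal (indicator {0..} (c * t) * (c * t) powr (x - 1) / exp (c * t)) \<partial>lborel)"
    using assms by (subst nn_integral_real_affine[where c = c and t = 0]) auto
  \<comment> \<open>The integrands agree even at \<open>t = 0\<close>, since
    \<open>0 powr (x - 1) = 0\<close>; this exchanges the closed half-line for the open one
    pointwise.\<close>
  also have "(\<integral>\<^sup>+t. ennreal (indicator {0..} (c * t) * (c * t) powr (x - 1) / exp (c * t)) \<partial>lborel)
     = (\<integral>\<^sup>+t. ennreal (c powr (x - 1)) * (ennreal (t powr (x - 1) * exp (- (c * t))) * indicator {0<..} t) \<partial>lborel)"
    using assms
    by (intro nn_integral_cong)
      (auto simp: indicator_def powr_mult exp_minus field_simps zero_less_mult_iff zero_le_mult_iff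
        simp flip: ennreal_mult)
  also have "\<dots> = ennreal (c powr (x - 1)) *
      (\<integral>\<^sup>+t. ennreal (t powr (x - 1) * exp (- (c * t))) * indicator {0<..} t \<partial>lborel)"
    by (rule nn_integral_cmult) simp
  finally have "ennreal (Gamma x) = ennreal (c powr x) *
      (\<integral>\<^sup>+t. ennreal (t powr (x - 1) * exp (- (c * t))) * indicator {0<..} t \<partial>lborel)"
    using assms by (simp add: powr_diff ennreal_mult'[symmetric] mult.assoc[symmetric])
  \<comment> \<open>The integral might a priori be infinite, so \<open>c powr x\<close> is removed
    by multiplying with its reciprocal and reassociating, which is valid for every \<open>J\<close>
    in \<open>ennreal\<close>.\<close>
  then have "ennreal (1 / c powr x) * ennreal (Gamma x) = ennreal (1 / c powr x) * (ennreal (c powr x) *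
      (\<integral>\<^sup>+t. ennreal (t powr (x - 1) * exp (- (c * t))) * indicator {0<..} t \<partial>lborel))"
    by (rule arg_cong)
  also have "ennreal (1 / c powr x) * (ennreal (c powr x) * J) = ennreal (1 / c powr x * c powr x) * J" for J
    by (simp only: ennreal_mult'' powr_ge_zero mult.assoc)
  finally show ?thesis
    using assms Gamma_real_pos[of x] by (simp flip: ennreal_mult')
qed

lemma nn_integral_exp_halfline:
  fixes c :: real
  assumes "0 < c"
  shows "(\<integral>\<^sup>+t. ennreal (exp (- (c * t))) * indicator {0<..} t \<partial>lborel) = ennreal (1 / c)"
proof -
  have "(\<integral>\<^sup>+t. ennreal (exp (- (c * t))) * indicator {0<..} t \<partial>lborel)
    = (\<integral>\<^sup>+t. ennreal (t powr (1 - 1) * exp (- (c * t))) * indicator {0<..} t \<partial>lborel)"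
    by (intro nn_integral_cong) (auto simp: indicator_def)
  also have "\<dots> = ennreal (1 / c)"
    using assms by (subst nn_integral_powr_times_exp) auto
  finally show ?thesis .
qed

lemma nn_integral_powr_tail:
  fixes s r :: real
  assumes "0 < s" "0 < r"
  shows "(\<integral>\<^sup>+t. ennreal (t powr (- 1 - s)) * indicator {r..} t \<partial>lborel) = ennreal (r powr (- s) / s)"
proof -
  have "((\<lambda>t. - (t powr (- s) / s)) \<longlongrightarrow> - (0 / s)) at_top"
    using assms by (intro tendsto_intros tendsto_neg_powr filterlim_ident) auto
  then have "(\<integral>\<^sup>+t. ennreal (t powr (- 1 - s)) * indicator {r..} t \<partial>lborel)
    = ennreal (- (0 / s) - - (r powr (- s) / s))"
    using assms
    by (intro nn_integral_FTC_atLeast)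
      (auto intro!: derivative_eq_intros simp: field_simps powr_diff powr_minus)
  then show ?thesis by simp
qed

lemma nn_integral_exp_initial:
  fixes a t :: real
  assumes "0 \<le> a" "0 \<le> t"
  shows "(\<integral>\<^sup>+r. ennreal (a * exp (- (a * r))) * indicator {0..t} r \<partial>lborel) = ennreal (1 - exp (- (a * t)))"
proof -
  have "(\<integral>\<^sup>+r. ennreal (a * exp (- (a * r))) * indicator {0..t} r \<partial>lborel)
    = ennreal (- exp (- (a * t)) - - exp (- (a * 0)))"
    using assms
    by (intro nn_integral_FTC_Icc) (auto intro!: derivative_eq_intros)
  then show ?thesis by simp
qed

section \<open>Gamma function identities behind the two normalising constants\<close>

text \<open>At an integer \<open>s\<close> both sides are 0: one Gamma factor sits at a pole, where
  its value is 0, and the right-hand side divides by 0.\<close>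

lemma Gamma_reflection_real:
  fixes s :: real
  shows "Gamma s * Gamma (1 - s) = pi / sin (pi * s)"
proof -
  have "complex_of_real (Gamma s * Gamma (1 - s)) = complex_of_real (pi / sin (pi * s))"
    using Gamma_reflection_complex[of "complex_of_real s"]
    by (simp add: Gamma_complex_of_real flip: sin_of_real of_real_diff)
      (metis Gamma_complex_of_real of_real_1 of_real_diff)
  then show ?thesis by (simp only: of_real_eq_iff)
qed

text \<open>This is the functional equation at \<open>- s\<close>, which lies strictly between -1
  and 0 and so is not a pole. It carries \<open>Gamma (- s)\<close> to an argument where the Gamma
  integral converges, and fixes its sign.\<close>

lemma Gamma_one_minus:
  fixes s :: real
  assumes "0 < s" "s < 1"
  shows "Gamma (1 - s) = - s * Gamma (- s)"
proof -
  have "- s \<notin> \<int>\<^sub>\<le>\<^sub>0"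
  proof
    assume "- s \<in> \<int>\<^sub>\<le>\<^sub>0"
    then obtain n where "- s = real_of_int n"
      by (auto elim!: nonpos_Ints_cases)
    then have "- 1 < n \<and> n < 0" using assms by linarith
    then show False by linarith
  qed
  then show ?thesis
    using Gamma_plus1[of "- s"] by (simp add: add.commute)
qed

section \<open>The scalar Balakrishnan and Bochner integrals\<close>

text \<open>After the exchange, the integral over \<open>t\<close> gives
  \<open>Gamma s * r powr (- s)\<close>, and the remaining integral over \<open>r\<close> is a Gamma
  integral of order \<open>1 - s\<close>. The constant is therefore
  \<open>Gamma s * Gamma (1 - s)\<close>, which the reflection formula evaluates, and the power is
  \<open>a * a powr (s - 1) = a powr s\<close>.\<close>

lemma nn_integral_balakrishnan:
  fixes s a :: real
  assumes s: "0 < s" "s < 1" and a: "0 < a"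
  shows "(\<integral>\<^sup>+t. ennreal (t powr (s - 1) * (a / (t + a))) * indicator {0<..} t \<partial>lborel)
    = ennreal (a powr s * (pi / sin (pi * s)))"
proof -
  have "(\<integral>\<^sup>+t. ennreal (t powr (s - 1) * (a / (t + a))) * indicator {0<..} t \<partial>lborel)
    = (\<integral>\<^sup>+t. \<integral>\<^sup>+r. ennreal (a * t powr (s - 1) * exp (- ((t + a) * r)))
        * indicator {0<..} t * indicator {0<..} r \<partial>lborel \<partial>lborel)"
  proof (intro nn_integral_cong)
    fix t :: real
    show "ennreal (t powr (s - 1) * (a / (t + a))) * indicator {0<..} t
      = (\<integral>\<^sup>+r. ennreal (a * t powr (s - 1) * exp (- ((t + a) * r)))
        * indicator {0<..} t * indicator {0<..} r \<partial>lborel)"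
    proof (cases "0 < t")
      case True
      have "(\<integral>\<^sup>+r. ennreal (a * t powr (s - 1) * exp (- ((t + a) * r)))
        * indicator {0<..} t * indicator {0<..} r \<partial>lborel)
        = (\<integral>\<^sup>+r. ennreal (a * t powr (s - 1)) * (ennreal (exp (- ((t + a) * r))) * indicator {0<..} r) \<partial>lborel)"
        using True a by (intro nn_integral_cong) (simp add: ennreal_mult' mult.assoc)
      also have "\<dots> = ennreal (a * t powr (s - 1)) * ennreal (1 / (t + a))"
        using True a by (subst nn_integral_cmult) (simp_all only: nn_integral_exp_halfline add_pos_pos, simp_all)
      finally show ?thesis using True a by (simp add: mult.commute flip: ennreal_mult')
    qed simp
  qed
  also have "\<dots> = (\<integral>\<^sup>+r. \<integral>\<^sup>+t. ennreal (a * t powr (s - 1) * exp (- ((t + a) * r)))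
        * indicator {0<..} t * indicator {0<..} r \<partial>lborel \<partial>lborel)"
    by (rule lborel_pair.Fubini') measurable
  also have "\<dots> = (\<integral>\<^sup>+r. ennreal (a * Gamma s) * (ennreal (r powr ((1 - s) - 1) * exp (- (a * r))) * indicator {0<..} r) \<partial>lborel)"
  proof (intro nn_integral_cong)
    fix r :: real
    show "(\<integral>\<^sup>+t. ennreal (a * t powr (s - 1) * exp (- ((t + a) * r)))
        * indicator {0<..} t * indicator {0<..} r \<partial>lborel)
      = ennreal (a * Gamma s) * (ennreal (r powr ((1 - s) - 1) * exp (- (a * r))) * indicator {0<..} r)"
    proof (cases "0 < r")
      case True
      have "(\<integral>\<^sup>+t. ennreal (a * t powr (s - 1) * exp (- ((t + a) * r)))
        * indicator {0<..} t * indicator {0<..} r \<partial>lborel)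
       = (\<integral>\<^sup>+t. ennreal (a * exp (- (a * r))) * (ennreal (t powr (s - 1) * exp (- (r * t))) * indicator {0<..} t) \<partial>lborel)"
      proof (intro nn_integral_cong)
        fix t :: real
        have "exp (- ((t + a) * r)) = exp (- (a * r)) * exp (- (r * t))"
          by (simp add: algebra_simps flip: exp_add)
        then show "ennreal (a * t powr (s - 1) * exp (- ((t + a) * r)))
            * indicator {0<..} t * indicator {0<..} r
          = ennreal (a * exp (- (a * r))) * (ennreal (t powr (s - 1) * exp (- (r * t))) * indicator {0<..} t)"
          using True a by (cases "0 < t") (simp_all add: mult_ac flip: ennreal_mult')
      qed
      also have "\<dots> = ennreal (a * exp (- (a * r))) * ennreal (Gamma s / r powr s)"
        using True s by (subst nn_integral_cmult) (simp_all only: nn_integral_powr_times_exp, simp_all)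
      also have "\<dots> = ennreal (a * Gamma s) * (ennreal (r powr ((1 - s) - 1) * exp (- (a * r))) * indicator {0<..} r)"
        using True a s Gamma_real_pos[of s]
        by (simp add: powr_minus divide_inverse mult_ac flip: ennreal_mult')
      finally show ?thesis .
    qed simp
  qed
  also have "\<dots> = ennreal (a * Gamma s) * ennreal (Gamma (1 - s) / a powr (1 - s))"
    using s a by (subst nn_integral_cmult) (simp_all add: nn_integral_powr_times_exp[where x = "1 - s", simplified])
  also have "\<dots> = ennreal (a powr s * (pi / sin (pi * s)))"
    using a s Gamma_real_pos[of s]
    by (simp add: powr_diff flip: ennreal_mult' Gamma_reflection_real)
  finally show ?thesis .
qed

text \<open>On the region \<open>0 < r \<le> t\<close> the integral over \<open>t\<close> is taken
  first and gives \<open>r powr (- s) / s\<close>. A Gamma integral of order \<open>1 - s\<close>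
  remains, and \<open>Gamma (1 - s) / s = - Gamma (- s)\<close>.\<close>

lemma nn_integral_bochner:
  fixes s a :: real
  assumes s: "0 < s" "s < 1" and a: "0 < a"
  shows "(\<integral>\<^sup>+t. ennreal ((1 - exp (- (a * t))) * t powr (- 1 - s)) * indicator {0<..} t \<partial>lborel)
    = ennreal (a powr s * (- Gamma (- s)))"
proof -
  have "(\<integral>\<^sup>+t. ennreal ((1 - exp (- (a * t))) * t powr (- 1 - s)) * indicator {0<..} t \<partial>lborel)
    = (\<integral>\<^sup>+t. \<integral>\<^sup>+r. ennreal (a * exp (- (a * r)) * t powr (- 1 - s))
        * indicator {0<..} r * indicator {r..} t \<partial>lborel \<partial>lborel)"
  proof (intro nn_integral_cong)
    fix t :: real
    show "ennreal ((1 - exp (- (a * t))) * t powr (- 1 - s)) * indicator {0<..} t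
      = (\<integral>\<^sup>+r. ennreal (a * exp (- (a * r)) * t powr (- 1 - s))
        * indicator {0<..} r * indicator {r..} t \<partial>lborel)"
    proof (cases "0 < t")
      case True
      \<comment> \<open>The indicators of \<open>{0<..}\<close> and \<open>{0..t}\<close> differ at
        \<open>r = 0\<close>, so the integrands agree only almost everywhere.\<close>
      have "AE r in lborel. r \<noteq> (0::real)" by (rule AE_lborel_singleton)
      then have "(\<integral>\<^sup>+r. ennreal (a * exp (- (a * r)) * t powr (- 1 - s))
        * indicator {0<..} r * indicator {r..} t \<partial>lborel)
        = (\<integral>\<^sup>+r. ennreal (t powr (- 1 - s)) * (ennreal (a * exp (- (a * r))) * indicator {0..t} r) \<partial>lborel)"
        using a by (intro nn_integral_cong_AE, elim eventually_mono)
          (auto simp: indicator_def mult_ac simp flip: ennreal_mult')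
      also have "\<dots> = ennreal (t powr (- 1 - s)) * ennreal (1 - exp (- (a * t)))"
        using True a by (subst nn_integral_cmult) (simp_all only: nn_integral_exp_initial less_imp_le, simp_all)
      finally show ?thesis using True a by (simp add: mult.commute flip: ennreal_mult')
    next
      case False
      then have "indicator {0<..} r * indicator {r..} t = (0::ennreal)" for r
        by (auto simp: indicator_def)
      then show ?thesis using False by (simp only: mult.assoc) simp
    qed
  qed
  also have "\<dots> = (\<integral>\<^sup>+r. \<integral>\<^sup>+t. ennreal (a * exp (- (a * r)) * t powr (- 1 - s))
        * indicator {0<..} r * indicator {r..} t \<partial>lborel \<partial>lborel)"
  proof (rule lborel_pair.Fubini')
    \<comment> \<open>The set \<open>{r..}\<close> varies with \<open>r\<close>; joint measurability
      is seen by reading its indicator as that of the closed half-plane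
      \<open>fst p \<le> snd p\<close>.\<close>
    have [measurable]: "(\<lambda>(r :: real, t). indicator {r..} t :: ennreal) \<in> borel_measurable (lborel \<Otimes>\<^sub>M lborel)"
    proof -
      have "(\<lambda>p :: real \<times> real. indicator {p. fst p \<le> snd p} p :: ennreal)
        \<in> borel_measurable (lborel \<Otimes>\<^sub>M lborel)"
        by measurable
      also have "(\<lambda>p :: real \<times> real. indicator {p. fst p \<le> snd p} p :: ennreal)
        = (\<lambda>(r, t). indicator {r..} t)"
        by (auto simp: indicator_def fun_eq_iff)
      finally show "(\<lambda>(r :: real, t). indicator {r..} t :: ennreal) \<in> borel_measurable (lborel \<Otimes>\<^sub>M lborel)" .
    qed
    show "(\<lambda>(r, t). ennreal (a * exp (- (a * r)) * t powr (- 1 - s))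
        * indicator {0<..} r * indicator {r..} t) \<in> borel_measurable (lborel \<Otimes>\<^sub>M lborel)"
      by measurable
  qed
  also have "\<dots> = (\<integral>\<^sup>+r. ennreal (a / s) * (ennreal (r powr ((1 - s) - 1) * exp (- (a * r))) * indicator {0<..} r) \<partial>lborel)"
  proof (intro nn_integral_cong)
    fix r :: real
    show "(\<integral>\<^sup>+t. ennreal (a * exp (- (a * r)) * t powr (- 1 - s))
        * indicator {0<..} r * indicator {r..} t \<partial>lborel)
      = ennreal (a / s) * (ennreal (r powr ((1 - s) - 1) * exp (- (a * r))) * indicator {0<..} r)"
    proof (cases "0 < r")
      case True
      have "(\<integral>\<^sup>+t. ennreal (a * exp (- (a * r)) * t powr (- 1 - s))
        * indicator {0<..} r * indicator {r..} t \<partial>lborel)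
       = (\<integral>\<^sup>+t. ennreal (a * exp (- (a * r))) * (ennreal (t powr (- 1 - s)) * indicator {r..} t) \<partial>lborel)"
        using True a by (intro nn_integral_cong) (simp add: ennreal_mult' mult.assoc)
      also have "\<dots> = ennreal (a * exp (- (a * r))) * ennreal (r powr (- s) / s)"
        using True s by (subst nn_integral_cmult) (simp_all only: nn_integral_powr_tail, simp_all)
      also have "\<dots> = ennreal (a / s) * (ennreal (r powr ((1 - s) - 1) * exp (- (a * r))) * indicator {0<..} r)"
        using True a s
        by (simp add: divide_inverse mult_ac flip: ennreal_mult')
      finally show ?thesis .
    qed simp
  qed
  also have "\<dots> = ennreal (a / s) * ennreal (Gamma (1 - s) / a powr (1 - s))"
    using s a by (subst nn_integral_cmult) (simp_all add: nn_integral_powr_times_exp[where x = "1 - s", simplified])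
  also have "\<dots> = ennreal (a powr s * (- Gamma (- s)))"
    using a s by (simp add: powr_diff Gamma_one_minus mult.commute flip: ennreal_mult')
  finally show ?thesis .
qed

text \<open>The nonnegative integral is finite, so it is also a Bochner integral. The case
  \<open>a = 0\<close>, which occurs when two zero eigenvalues meet, is separate: the integrand
  vanishes and \<open>0 powr s = 0\<close>.\<close>

lemma has_bochner_integral_balakrishnan:
  fixes s a :: real
  assumes s: "0 < s" "s < 1" and a: "0 \<le> a"
  shows "has_bochner_integral lborel (\<lambda>t. indicator {0<..} t *\<^sub>R (t powr (s - 1) * (a / (t + a))))
    (a powr s * (pi / sin (pi * s)))"
proof (cases "a = 0")
  case False
  with a have a: "0 < a" by simp
  have "0 < sin (pi * s)" using s by (intro sin_gt_zero) auto
  then show ?thesis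
    using a nn_integral_balakrishnan[OF s a]
    by (intro has_bochner_integral_nn_integral)
      (auto simp: indicator_def intro!: nn_integral_cong elim!: trans[rotated])
qed (simp add: has_bochner_integral_zero)

text \<open>The integrand is nonpositive, so its negative is integrated first and the sign is
  restored at the end; this matches \<open>Gamma (- s) < 0\<close>. For \<open>a = 0\<close> both
  sides are 0.\<close>

lemma has_bochner_integral_bochner:
  fixes s a :: real
  assumes s: "0 < s" "s < 1" and a: "0 \<le> a"
  shows "has_bochner_integral lborel (\<lambda>t. indicator {0<..} t *\<^sub>R ((exp (- (a * t)) - 1) * t powr (- 1 - s)))
    (a powr s * Gamma (- s))"
proof (cases "a = 0")
  case False
  with a have a: "0 < a" by simp
  have neg: "Gamma (- s) < 0"
    using Gamma_real_pos[of "1 - s"] s by (simp add: Gamma_one_minus zero_less_mult_iff mult_less_0_iff)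
  have "has_bochner_integral lborel (\<lambda>t. indicator {0<..} t *\<^sub>R ((1 - exp (- (a * t))) * t powr (- 1 - s)))
    (a powr s * (- Gamma (- s)))"
    using a neg nn_integral_bochner[OF s a]
    by (intro has_bochner_integral_nn_integral)
      (auto simp: indicator_def mult_nonneg_nonpos intro!: nn_integral_cong elim!: trans[rotated])
  from has_bochner_integral_minus[OF this] show ?thesis
    by (simp add: algebra_simps)
qed (simp add: has_bochner_integral_zero)

subsection \<open>The exponential of a diagonalized matrix\<close>

lemma cmat_mult: "cmat (A ** B) = cmat A ** cmat B"
  by (simp add: vec_eq_iff matrix_matrix_mult_def)

lemma cmat_mat: "cmat (mat 1) = mat 1"
  by (simp add: vec_eq_iff mat_def)

lemma cmat_transpose: "cmat (transpose A) = transpose (cmat A)"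
  by (simp add: vec_eq_iff transpose_def)

lemma matrix_inv_cancel:
  assumes "invertible A"
  shows "A ** matrix_inv A = mat 1" "matrix_inv A ** A = mat 1"
proof -
  have "A ** matrix_inv A = mat 1 \<and> matrix_inv A ** A = mat 1"
    using assms unfolding invertible_def matrix_inv_def by (rule someI_ex)
  then show "A ** matrix_inv A = mat 1" "matrix_inv A ** A = mat 1" by simp_all
qed

lemma diag_matrix_mult_nth:
  "(diag_matrix d ** A) $ i $ j = d $ i * (A $ i $ j :: 'a::semiring_1)"
  by (simp add: diag_matrix_def matrix_matrix_mult_def if_distrib[of "\<lambda>x. x * _"] cong: if_cong)

lemma mult_diag_matrix_nth:
  "(A ** diag_matrix d) $ i $ j = (A $ i $ j :: 'a::semiring_1) * d $ j"
  by (simp add: diag_matrix_def matrix_matrix_mult_def if_distrib[of "\<lambda>x. _ * x"] cong: if_cong)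

lemma transpose_diag_matrix: "transpose (diag_matrix d) = diag_matrix d"
  by (simp add: vec_eq_iff transpose_def diag_matrix_def)

lemma cmat_diag_matrix: "cmat (diag_matrix d) = diag_matrix (\<chi> i. complex_of_real (d $ i))"
  by (simp add: vec_eq_iff diag_matrix_def)

lemma scaleR_diag_matrix:
  fixes d :: "'a::real_vector ^ 'n"
  shows "t *\<^sub>R diag_matrix d = diag_matrix (t *\<^sub>R d)"
  by (simp add: vec_eq_iff diag_matrix_def)

text \<open>Intertwining replaces similarity here: the same statement serves a matrix acting from
  the left, with \<open>N\<close> diagonal, and one acting from the right, with \<open>M\<close>
  diagonal.\<close>

lemma matrix_power_intertwine:
  assumes "M ** P = P ** N"
  shows "matrix_power M k ** P = P ** matrix_power N k"
proof (induction k)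
  case (Suc k)
  have "matrix_power M (Suc k) ** P = M ** (matrix_power M k ** P)"
    by (simp add: matrix_power_def matrix_mul_assoc)
  also have "\<dots> = P ** matrix_power N (Suc k)"
    by (simp add: Suc.IH matrix_mul_assoc assms) (simp add: matrix_power_def flip: matrix_mul_assoc)
  finally show ?case .
qed (simp add: matrix_power_def)

text \<open>Multiplication by \<open>P\<close> from either side is linear on a finite-dimensional
  space, hence continuous, so it passes through the exponential series; the two resulting series
  agree term by term.\<close>

lemma matrix_exp_intertwine:
  fixes M :: "complex ^ 'm ^ 'm" and N :: "complex ^ 'n ^ 'n"
  assumes "M ** P = P ** N"
  shows "matrix_exp M ** P = P ** matrix_exp N"
proof -
  have "linear (\<lambda>X. X ** P)"
    by (rule linearI)
      (simp_all add: vec_eq_iff matrix_matrix_mult_def distrib_right sum.distrib scaleR_sum_right)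
  then have l: "bounded_linear (\<lambda>X. X ** P)"
    by (simp only: linear_conv_bounded_linear)
  have "linear (\<lambda>X. P ** X)"
    by (rule linearI)
      (simp_all add: vec_eq_iff matrix_matrix_mult_def distrib_left sum.distrib scaleR_sum_right)
  then have r: "bounded_linear (\<lambda>X. P ** X)"
    by (simp only: linear_conv_bounded_linear)
  have "(\<lambda>k. ((1 / fact k) *\<^sub>R matrix_power M k) ** P) sums (matrix_exp M ** P)"
    by (rule bounded_linear.sums[OF l matrix_exp_sums])
  moreover have "(\<lambda>k. P ** ((1 / fact k) *\<^sub>R matrix_power N k)) sums (P ** matrix_exp N)"
    by (rule bounded_linear.sums[OF r matrix_exp_sums])
  moreover have "((1 / fact k) *\<^sub>R matrix_power M k) ** P = P ** ((1 / fact k) *\<^sub>R matrix_power N k)" for k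
    using matrix_power_intertwine[OF assms, of k] by (simp add: matrix_scalar_ac flip: scalar_matrix_assoc)
  ultimately show ?thesis by (simp add: sums_unique2)
qed

lemma matrix_power_diag_matrix:
  "matrix_power (diag_matrix d) k = diag_matrix (\<chi> i. (d $ i) ^ k)"
proof (induction k)
  case 0
  then show ?case by (simp add: matrix_power_def vec_eq_iff mat_def diag_matrix_def)
next
  case (Suc k)
  have "matrix_power (diag_matrix d) (Suc k) = diag_matrix d ** matrix_power (diag_matrix d) k"
    by (simp add: matrix_power_def)
  then show ?case
    by (simp add: Suc vec_eq_iff diag_matrix_mult_nth) (simp add: diag_matrix_def)
qed

lemma matrix_exp_diag_matrix: "matrix_exp (diag_matrix d) = diag_matrix (\<chi> i. exp (d $ i))"
proof -
  have "matrix_exp (diag_matrix d) $ i $ j = diag_matrix (\<chi> i. exp (d $ i)) $ i $ j" for i j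
  proof -
    have "(\<lambda>k. ((1 / fact k) *\<^sub>R matrix_power (diag_matrix d) k) $ i $ j) sums (matrix_exp (diag_matrix d) $ i $ j)"
      by (intro sums_vec_nth matrix_exp_sums)
    moreover have "(\<lambda>k. ((1 / fact k) *\<^sub>R matrix_power (diag_matrix d) k) $ i $ j) sums
      (diag_matrix (\<chi> i. exp (d $ i)) $ i $ j)"
      using exp_converges[of "d $ i"]
      by (simp only: matrix_power_diag_matrix) (auto simp: diag_matrix_def divide_inverse)
    ultimately show ?thesis by (rule sums_unique2)
  qed
  then show ?thesis by (simp add: vec_eq_iff)
qed

subsection \<open>The discrete Laplacian in eigenvector coordinates\<close>

locale diagonalized_pair =
  fixes Dxx Px :: "real ^ 'm ^ 'm" and Dyy Py :: "real ^ 'n ^ 'n"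
    and lx :: "real ^ 'm" and ly :: "real ^ 'n"
  assumes inv: "invertible Px" "invertible Py"
    and Dxx: "Dxx = Px ** diag_matrix lx ** matrix_inv Px"
    and Dyy: "Dyy = Py ** diag_matrix ly ** matrix_inv Py"
    and lx: "\<And>i. lx $ i \<le> 0"
    and ly: "\<And>j. ly $ j \<le> 0"
begin

text \<open>With \<open>p k\<close> and \<open>q l\<close> the columns of \<open>Px\<close> and
  \<open>Py\<close>, this is the sum of \<open>V $ k $ l\<close> times the rank-one matrices
  \<open>p k (q l)^T\<close>, which form an eigenbasis of the discrete Laplacian.\<close>

definition synth :: "complex ^ 'n ^ 'm \<Rightarrow> complex ^ 'n ^ 'm" where
  "synth V = cmat Px ** V ** cmat (transpose Py)"

definition coeffs :: "complex ^ 'n ^ 'm \<Rightarrow> complex ^ 'n ^ 'm" where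
  "coeffs V = cmat (matrix_inv Px) ** V ** cmat (matrix_inv (transpose Py))"

text \<open>In eigenvector coordinates, Hadamard multiplication by this matrix is the function
  \<open>f\<close> of the discrete Laplacian.\<close>

definition multiplier :: "(real \<Rightarrow> real) \<Rightarrow> complex ^ 'n ^ 'm" where
  "multiplier f = (\<chi> i j. complex_of_real (f (lx $ i + ly $ j)))"

lemma inverse_cmat:
  "cmat Px ** cmat (matrix_inv Px) = mat 1" "cmat (matrix_inv Px) ** cmat Px = mat 1"
  "cmat (transpose Py) ** cmat (matrix_inv (transpose Py)) = mat 1"
  "cmat (matrix_inv (transpose Py)) ** cmat (transpose Py) = mat 1"
  using inv transpose_invertible[OF inv(2)]
  by (simp_all add: cmat_mat matrix_inv_cancel flip: cmat_mult)

lemma synth_coeffs [simp]: "synth (coeffs V) = V"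
proof -
  have "synth (coeffs V) = (cmat Px ** cmat (matrix_inv Px)) ** V
      ** (cmat (matrix_inv (transpose Py)) ** cmat (transpose Py))"
    by (simp only: synth_def coeffs_def matrix_mul_assoc)
  then show ?thesis by (simp add: inverse_cmat)
qed

lemma coeffs_synth [simp]: "coeffs (synth V) = V"
proof -
  have "coeffs (synth V) = (cmat (matrix_inv Px) ** cmat Px) ** V
      ** (cmat (transpose Py) ** cmat (matrix_inv (transpose Py)))"
    by (simp only: synth_def coeffs_def matrix_mul_assoc)
  then show ?thesis by (simp add: inverse_cmat)
qed

lemma synth_nth:
  "synth V $ i $ j = (\<Sum>l\<in>UNIV. \<Sum>k\<in>UNIV. cmat Px $ i $ k * V $ k $ l * cmat (transpose Py) $ l $ j)"
  by (simp add: synth_def matrix_matrix_mult_def sum_distrib_right)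

lemma linear_synth: "linear synth"
  by (rule linearI)
    (simp_all add: vec_eq_iff synth_nth distrib_left distrib_right sum.distrib scaleR_sum_right)

lemma Dxx_intertwine:
  "cmat Dxx ** cmat Px = cmat Px ** diag_matrix (\<chi> i. complex_of_real (lx $ i))"
proof -
  have "cmat Dxx ** cmat Px
    = cmat Px ** cmat (diag_matrix lx) ** (cmat (matrix_inv Px) ** cmat Px)"
    by (simp only: Dxx cmat_mult matrix_mul_assoc)
  then show ?thesis by (simp add: inverse_cmat cmat_diag_matrix)
qed

text \<open>The transpose of \<open>Dyy\<close> acts from the right, so the eigenvector relation
  \<open>Dyy ** Py = Py ** diag_matrix ly\<close> is used in transposed form.\<close>

lemma Dyy_intertwine:
  "cmat (transpose Py) ** transpose (cmat Dyy)
    = diag_matrix (\<chi> j. complex_of_real (ly $ j)) ** cmat (transpose Py)"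
proof -
  have "Dyy ** Py = Py ** diag_matrix ly ** (matrix_inv Py ** Py)"
    by (simp only: Dyy matrix_mul_assoc)
  then have "Dyy ** Py = Py ** diag_matrix ly"
    using inv by (simp add: matrix_inv_cancel)
  then have "transpose Py ** transpose Dyy = diag_matrix ly ** transpose Py"
    by (metis matrix_transpose_mul transpose_diag_matrix)
  then show ?thesis
    by (metis cmat_mult cmat_transpose cmat_diag_matrix)
qed

text \<open>The two intertwining relations turn the summands into diagonal scalings of the rows and
  of the columns of \<open>V\<close>; together they multiply entry \<open>(i, j)\<close> by
  \<open>lx $ i + ly $ j\<close>.\<close>

lemma discrete_laplacian_synth:
  "discrete_laplacian Dxx Dyy (synth V) = synth (multiplier (\<lambda>z. z) * V)"
proof -
  have "discrete_laplacian Dxx Dyy (synth V)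
    = (cmat Dxx ** cmat Px) ** V ** cmat (transpose Py)
      + cmat Px ** V ** (cmat (transpose Py) ** transpose (cmat Dyy))"
    by (simp only: discrete_laplacian_def synth_def matrix_mul_assoc)
  also have "\<dots> = synth (diag_matrix (\<chi> i. complex_of_real (lx $ i)) ** V)
      + synth (V ** diag_matrix (\<chi> j. complex_of_real (ly $ j)))"
    by (simp only: Dxx_intertwine Dyy_intertwine synth_def matrix_mul_assoc)
  also have "\<dots> = synth (diag_matrix (\<chi> i. complex_of_real (lx $ i)) ** V
      + V ** diag_matrix (\<chi> j. complex_of_real (ly $ j)))"
    by (rule linear_add[OF linear_synth, symmetric])
  also have "diag_matrix (\<chi> i. complex_of_real (lx $ i)) ** V
      + V ** diag_matrix (\<chi> j. complex_of_real (ly $ j)) = multiplier (\<lambda>z. z) * V"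
    by (simp add: vec_eq_iff diag_matrix_mult_nth mult_diag_matrix_nth multiplier_def algebra_simps)
  finally show ?thesis .
qed

section \<open>Resolvent and heat semigroup as multipliers\<close>

text \<open>In coefficients the equation is entrywise division by
  \<open>t - (lx $ i + ly $ j)\<close>, which is positive. The equivalence gives existence and
  uniqueness at once and so evaluates the \<open>THE\<close> in
  \<open>discrete_resolvent\<close>.\<close>

lemma resolvent_equation_iff:
  assumes "0 < t"
  shows "resolvent_equation Dxx Dyy t U V \<longleftrightarrow> V = synth (multiplier (\<lambda>z. 1 / (t - z)) * coeffs U)"
proof -
  have nz: "complex_of_real t - (complex_of_real (lx $ i) + complex_of_real (ly $ j)) \<noteq> 0" for i j
  proof -
    have "t - (lx $ i + ly $ j) \<noteq> 0" using assms lx[of i] ly[of j] by linarith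
    then show ?thesis by (metis of_real_add of_real_diff of_real_eq_0_iff)
  qed
  have "resolvent_equation Dxx Dyy t U V \<longleftrightarrow> t *\<^sub>R V - discrete_laplacian Dxx Dyy V = U"
    by (simp add: resolvent_equation_def discrete_laplacian_def algebra_simps)
  also have "\<dots> \<longleftrightarrow> t *\<^sub>R synth (coeffs V) - discrete_laplacian Dxx Dyy (synth (coeffs V)) = synth (coeffs U)"
    by simp
  also have "\<dots> \<longleftrightarrow> synth (multiplier (\<lambda>z. t - z) * coeffs V) = synth (coeffs U)"
  proof -
    have "t *\<^sub>R synth (coeffs V) - discrete_laplacian Dxx Dyy (synth (coeffs V))
      = synth (t *\<^sub>R coeffs V - multiplier (\<lambda>z. z) * coeffs V)"
      by (simp only: discrete_laplacian_synth linear_diff[OF linear_synth] linear_scale[OF linear_synth])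
    also have "t *\<^sub>R coeffs V - multiplier (\<lambda>z. z) * coeffs V = multiplier (\<lambda>z. t - z) * coeffs V"
      by (simp add: vec_eq_iff multiplier_def algebra_simps) (simp add: scaleR_conv_of_real)
    finally show ?thesis by simp
  qed
  also have "\<dots> \<longleftrightarrow> multiplier (\<lambda>z. t - z) * coeffs V = coeffs U"
    by (metis coeffs_synth)
  also have "\<dots> \<longleftrightarrow> coeffs V = multiplier (\<lambda>z. 1 / (t - z)) * coeffs U"
    using nz by (auto simp: vec_eq_iff multiplier_def field_simps)
  also have "\<dots> \<longleftrightarrow> V = synth (multiplier (\<lambda>z. 1 / (t - z)) * coeffs U)"
    by (metis coeffs_synth synth_coeffs)
  finally show ?thesis .
qed

text \<open>The symbol \<open>- z\<close> of the negative Laplacian times the symbol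
  \<open>1 / (t - z)\<close> of the resolvent is written as \<open>- z / (t + - z)\<close> to match
  the scalar integrand at \<open>a = - z\<close>.\<close>

lemma balakrishnan_integrand_eq:
  assumes "0 < t"
  shows "balakrishnan_integrand s Dxx Dyy U t
    = synth (multiplier (\<lambda>z. t powr (s - 1) * (- z / (t + - z))) * coeffs U)"
proof -
  have "discrete_resolvent Dxx Dyy t U = synth (multiplier (\<lambda>z. 1 / (t - z)) * coeffs U)"
    using assms by (simp add: discrete_resolvent_def resolvent_equation_iff)
  then have "balakrishnan_integrand s Dxx Dyy U t = (- (1 / t powr (1 - s))) *\<^sub>R
      synth (multiplier (\<lambda>z. z) * (multiplier (\<lambda>z. 1 / (t - z)) * coeffs U))"
    by (simp add: balakrishnan_integrand_def discrete_laplacian_synth)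
  also have "\<dots> = synth ((- (1 / t powr (1 - s))) *\<^sub>R
      (multiplier (\<lambda>z. z) * (multiplier (\<lambda>z. 1 / (t - z)) * coeffs U)))"
    by (rule linear_scale[OF linear_synth, symmetric])
  also have "(- (1 / t powr (1 - s))) *\<^sub>R
      (multiplier (\<lambda>z. z) * (multiplier (\<lambda>z. 1 / (t - z)) * coeffs U))
      = multiplier (\<lambda>z. t powr (s - 1) * (- z / (t + - z))) * coeffs U"
  proof -
    have "1 / t powr (1 - s) = t powr (s - 1)"
      using powr_minus_divide[of t "1 - s"] by simp
    then show ?thesis
      by (simp add: vec_eq_iff multiplier_def scaleR_conv_of_real[where 'a = complex])
  qed
  finally show ?thesis .
qed

lemma bochner_integrand_eq:
  assumes "0 < t"
  shows "bochner_integrand s Dxx Dyy U t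
    = synth (multiplier (\<lambda>z. (exp (- (- z * t)) - 1) * t powr (- 1 - s)) * coeffs U)"
proof -
  let ?ex = "diag_matrix (\<chi> i. exp (complex_of_real (t * lx $ i)))"
  let ?ey = "diag_matrix (\<chi> j. exp (complex_of_real (t * ly $ j)))"
  have x: "matrix_exp (t *\<^sub>R cmat Dxx) ** cmat Px = cmat Px ** ?ex"
  proof -
    have "(t *\<^sub>R cmat Dxx) ** cmat Px = cmat Px ** (t *\<^sub>R diag_matrix (\<chi> i. complex_of_real (lx $ i)))"
      by (simp add: matrix_scalar_ac Dxx_intertwine flip: scalar_matrix_assoc)
    from matrix_exp_intertwine[OF this] show ?thesis
      by (simp add: scaleR_diag_matrix matrix_exp_diag_matrix scaleR_conv_of_real[where 'a = complex])
  qed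
  \<comment> \<open>The exponential now stands to the right of the eigenvector matrix, so the
    diagonal matrix takes the role of \<open>M\<close> in the intertwining.\<close>
  have y: "cmat (transpose Py) ** matrix_exp (t *\<^sub>R transpose (cmat Dyy)) = ?ey ** cmat (transpose Py)"
  proof -
    have "(t *\<^sub>R diag_matrix (\<chi> j. complex_of_real (ly $ j))) ** cmat (transpose Py)
      = cmat (transpose Py) ** (t *\<^sub>R transpose (cmat Dyy))"
      by (simp add: matrix_scalar_ac Dyy_intertwine flip: scalar_matrix_assoc)
    from matrix_exp_intertwine[OF this] show ?thesis
      by (simp add: scaleR_diag_matrix matrix_exp_diag_matrix scaleR_conv_of_real[where 'a = complex])
  qed
  have "discrete_heat Dxx Dyy t U = discrete_heat Dxx Dyy t (synth (coeffs U))" by simp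
  also have "\<dots> = (matrix_exp (t *\<^sub>R cmat Dxx) ** cmat Px) ** coeffs U
      ** (cmat (transpose Py) ** matrix_exp (t *\<^sub>R transpose (cmat Dyy)))"
    by (simp only: discrete_heat_def synth_def matrix_mul_assoc)
  also have "\<dots> = synth (?ex ** coeffs U ** ?ey)"
    by (simp only: x y synth_def matrix_mul_assoc)
  finally have heat: "discrete_heat Dxx Dyy t U = synth (?ex ** coeffs U ** ?ey)" .
  have "bochner_integrand s Dxx Dyy U t
    = (1 / t powr (1 + s)) *\<^sub>R (synth (?ex ** coeffs U ** ?ey) - synth (coeffs U))"
    by (simp add: bochner_integrand_def heat)
  also have "\<dots> = synth ((1 / t powr (1 + s)) *\<^sub>R (?ex ** coeffs U ** ?ey - coeffs U))"
    by (simp only: linear_diff[OF linear_synth] linear_scale[OF linear_synth])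
  \<comment> \<open>Row scaling by \<open>exp (t * lx $ i)\<close> and column scaling by
    \<open>exp (t * ly $ j)\<close> combine to the exponential of \<open>t\<close> times the
    eigenvalue sum.\<close>
  also have "(1 / t powr (1 + s)) *\<^sub>R (?ex ** coeffs U ** ?ey - coeffs U)
      = multiplier (\<lambda>z. (exp (- (- z * t)) - 1) * t powr (- 1 - s)) * coeffs U"
  proof -
    have "1 / t powr (1 + s) = t powr (- 1 - s)"
      using powr_minus_divide[of t "1 + s"] by simp
    then show ?thesis
      by (simp add: vec_eq_iff multiplier_def scaleR_conv_of_real[where 'a = complex] diag_matrix_mult_nth
          mult_diag_matrix_nth exp_add algebra_simps flip: exp_of_real)
  qed
  finally show ?thesis .
qed

section \<open>From scalar to entrywise integrals\<close>

text \<open>Each entry of \<open>synth\<close> is a finite linear combination of multiplier values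
  at the sums \<open>lx $ k + ly $ l \<le> 0\<close>, so integrability and the value of the integral
  follow from the scalar case.\<close>

lemma has_bochner_integral_synth_multiplier:
  fixes f :: "real \<Rightarrow> real \<Rightarrow> real" and c :: "real \<Rightarrow> real"
  assumes F: "\<And>t. 0 < t \<Longrightarrow> F t = synth (multiplier (f t) * W)"
    and f: "\<And>z. z \<le> 0 \<Longrightarrow> has_bochner_integral lborel (\<lambda>t. indicator {0<..} t *\<^sub>R f t z) (c z)"
  shows "has_bochner_integral lborel (\<lambda>t. indicator {0<..} t *\<^sub>R F t $ i $ j)
    (synth (multiplier c * W) $ i $ j)"
proof -
  have "has_bochner_integral lborel
      (\<lambda>t. \<Sum>l\<in>UNIV. \<Sum>k\<in>UNIV. cmat Px $ i $ k * (complex_of_real (indicator {0<..} t *\<^sub>R f t (lx $ k + ly $ l)) * W $ k $ l)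
         * cmat (transpose Py) $ l $ j)
      (\<Sum>l\<in>UNIV. \<Sum>k\<in>UNIV. cmat Px $ i $ k * (complex_of_real (c (lx $ k + ly $ l)) * W $ k $ l)
         * cmat (transpose Py) $ l $ j)"
    by (intro has_bochner_integral_sum has_bochner_integral_mult_left has_bochner_integral_mult_right
        has_bochner_integral_of_real f add_nonpos_nonpos lx ly)
  also have "(\<lambda>t. \<Sum>l\<in>UNIV. \<Sum>k\<in>UNIV. cmat Px $ i $ k * (complex_of_real (indicator {0<..} t *\<^sub>R f t (lx $ k + ly $ l)) * W $ k $ l)
         * cmat (transpose Py) $ l $ j) = (\<lambda>t. indicator {0<..} t *\<^sub>R F t $ i $ j)"
    by (rule ext) (simp add: F synth_nth multiplier_def indicator_def)
  finally show ?thesis by (simp add: synth_nth multiplier_def)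
qed

lemma multiplier_entrywise_powr:
  assumes "\<And>i j. Lxy $ i $ j = lx $ i + ly $ j"
  shows "multiplier (\<lambda>z. (- z) powr s) = cmat (entrywise_powr (- Lxy) s)"
  using assms by (simp add: vec_eq_iff multiplier_def entrywise_powr_def)

lemma entrywise_integral_synth:
  fixes f :: "real \<Rightarrow> real \<Rightarrow> real" and c :: "real \<Rightarrow> real"
  assumes F: "\<And>t. 0 < t \<Longrightarrow> F t = synth (multiplier (f t) * W)"
    and f: "\<And>z. z \<le> 0 \<Longrightarrow> has_bochner_integral lborel (\<lambda>t. indicator {0<..} t *\<^sub>R f t z) (c z)"
  shows "entrywise_integrable F" "entrywise_integral F = synth (multiplier c * W)"
  using has_bochner_integral_synth_multiplier[OF assms]
  by (simp_all add: entrywise_integrable_def entrywise_integral_def set_integrable_def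
      set_lebesgue_integral_def has_bochner_integral_iff vec_eq_iff)

text \<open>Cancels the prefactor \<open>r\<close> of a representation against the constant
  \<open>d\<close> produced by its scalar integral.\<close>

lemma scaleR_synth_multiplier:
  "r *\<^sub>R synth (multiplier (\<lambda>z. c z * d) * W) = synth (multiplier c * W)" if "r * d = 1"
proof -
  have "r *\<^sub>R (multiplier (\<lambda>z. c z * d) * W) = multiplier c * W"
    using that
    by (simp add: vec_eq_iff multiplier_def scaleR_conv_of_real[where 'a = complex] mult_ac
        flip: of_real_mult)
  then show ?thesis by (simp flip: linear_scale[OF linear_synth])
qed

end

theorem theorem3p1:
  fixes s :: real
    and x :: "real ^ 'm" and y :: "real ^ 'n"
    and Dxx Px :: "real ^ 'm ^ 'm" and Dyy Py :: "real ^ 'n ^ 'n"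
    and lx :: "real ^ 'm" and ly :: "real ^ 'n"
    and u :: "real \<times> real \<Rightarrow> complex"
    and U :: "complex ^ 'n ^ 'm"
    and Lxy :: "real ^ 'n ^ 'm"
  assumes s: "0 < s" "s < 1"
    and neg: "neg_semidefinite Dxx" "neg_semidefinite Dyy"
    and inv: "invertible Px" "invertible Py"
    and Dxx: "Dxx = Px ** diag_matrix lx ** matrix_inv Px"
    and Dyy: "Dyy = Py ** diag_matrix ly ** matrix_inv Py"
    and lx: "\<And>i. lx $ i \<le> 0"
    and ly: "\<And>j. ly $ j \<le> 0"
    and U: "\<And>i j. U $ i $ j = u (x $ i, y $ j)"
    and Lxy: "\<And>i j. Lxy $ i $ j = lx $ i + ly $ j"
  shows "(\<forall>t>0. \<exists>!V. resolvent_equation Dxx Dyy t U V)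
    \<and> entrywise_integrable (balakrishnan_integrand s Dxx Dyy U)
    \<and> entrywise_integrable (bochner_integrand s Dxx Dyy U)
    \<and> (sin (pi * s) / pi) *\<^sub>R entrywise_integral (balakrishnan_integrand s Dxx Dyy U)
        = cmat Px ** (cmat (entrywise_powr (- Lxy) s)
            * (cmat (matrix_inv Px) ** U ** cmat (matrix_inv (transpose Py))))
          ** cmat (transpose Py)
    \<and> (1 / Gamma (- s)) *\<^sub>R entrywise_integral (bochner_integrand s Dxx Dyy U)
        = cmat Px ** (cmat (entrywise_powr (- Lxy) s)
            * (cmat (matrix_inv Px) ** U ** cmat (matrix_inv (transpose Py))))
          ** cmat (transpose Py)"
proof -
  interpret diagonalized_pair Dxx Px Dyy Py lx ly
    using inv Dxx Dyy lx ly by unfold_locales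
  have sin: "0 < sin (pi * s)" using s by (intro sin_gt_zero) auto
  \<comment> \<open>A zero value would make \<open>Gamma (1 - s) = - s * Gamma (- s)\<close> vanish,
    although it is positive; the prefactor \<open>1 / Gamma (- s)\<close> is thus a genuine
    reciprocal.\<close>
  have Gamma: "Gamma (- s) \<noteq> 0"
    using Gamma_real_pos[of "1 - s"] s by (auto simp: Gamma_one_minus)
  \<comment> \<open>The claimed matrix formula is the function \<open>(- z) powr s\<close> of the
    discrete Laplacian, applied to \<open>U\<close>.\<close>
  have rhs: "cmat Px ** (cmat (entrywise_powr (- Lxy) s)
      * (cmat (matrix_inv Px) ** U ** cmat (matrix_inv (transpose Py)))) ** cmat (transpose Py)
    = synth (multiplier (\<lambda>z. (- z) powr s) * coeffs U)"
    by (simp only: synth_def coeffs_def multiplier_entrywise_powr[OF Lxy])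
  have bal: "has_bochner_integral lborel
      (\<lambda>t. indicator {0<..} t *\<^sub>R (t powr (s - 1) * (- z / (t + - z))))
      ((- z) powr s * (pi / sin (pi * s)))" if "z \<le> 0" for z
    using has_bochner_integral_balakrishnan[OF s, of "- z"] that by simp
  have boc: "has_bochner_integral lborel
      (\<lambda>t. indicator {0<..} t *\<^sub>R ((exp (- (- z * t)) - 1) * t powr (- 1 - s)))
      ((- z) powr s * Gamma (- s))" if "z \<le> 0" for z
    using has_bochner_integral_bochner[OF s, of "- z"] that by simp
  have bal_integral: "entrywise_integrable (balakrishnan_integrand s Dxx Dyy U)"
    "entrywise_integral (balakrishnan_integrand s Dxx Dyy U)
      = synth (multiplier (\<lambda>z. (- z) powr s * (pi / sin (pi * s))) * coeffs U)"
    by (rule entrywise_integral_synth[where f = "\<lambda>t z. t powr (s - 1) * (- z / (t + - z))"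
          and c = "\<lambda>z. (- z) powr s * (pi / sin (pi * s))" and W = "coeffs U"];
        (erule balakrishnan_integrand_eq | erule bal))+
  have boc_integral: "entrywise_integrable (bochner_integrand s Dxx Dyy U)"
    "entrywise_integral (bochner_integrand s Dxx Dyy U)
      = synth (multiplier (\<lambda>z. (- z) powr s * Gamma (- s)) * coeffs U)"
    by (rule entrywise_integral_synth[where f = "\<lambda>t z. (exp (- (- z * t)) - 1) * t powr (- 1 - s)"
          and c = "\<lambda>z. (- z) powr s * Gamma (- s)" and W = "coeffs U"];
        (erule bochner_integrand_eq | erule boc))+
  show ?thesis
  proof (intro conjI)
    show "\<forall>t>0. \<exists>!V. resolvent_equation Dxx Dyy t U V"
      by (simp add: resolvent_equation_iff)
    show "entrywise_integrable (balakrishnan_integrand s Dxx Dyy U)"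
      by (rule bal_integral(1))
    show "entrywise_integrable (bochner_integrand s Dxx Dyy U)"
      by (rule boc_integral(1))
    show "(sin (pi * s) / pi) *\<^sub>R entrywise_integral (balakrishnan_integrand s Dxx Dyy U)
        = cmat Px ** (cmat (entrywise_powr (- Lxy) s)
            * (cmat (matrix_inv Px) ** U ** cmat (matrix_inv (transpose Py))))
          ** cmat (transpose Py)"
      unfolding rhs bal_integral(2) by (rule scaleR_synth_multiplier) (use sin in simp)
    show "(1 / Gamma (- s)) *\<^sub>R entrywise_integral (bochner_integrand s Dxx Dyy U)
        = cmat Px ** (cmat (entrywise_powr (- Lxy) s)
            * (cmat (matrix_inv Px) ** U ** cmat (matrix_inv (transpose Py))))
          ** cmat (transpose Py)"
      unfolding rhs boc_integral(2) by (rule scaleR_synth_multiplier) (use Gamma in simp)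
  qed
qed

end
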